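(* Let $f:\mathbb{R}^{2}\rightarrow \mathbb{R}^{2}$, $f(x,y)=(f_1(x,y),f_2(x,y))$, be an entire (i.e. defined on all of $\mathbb{R}^2$) smooth map such that its graph $$G_f=\{(x,y,f_1(x,y),f_2(x,y))\in\mathbb{R}^4:(x,y)\in\mathbb{R}^2\}$$ is a minimal surface in $\mathbb{R}^4$. If the Jacobian $J_f=\det(df)=\frac{\partial f_1}{\partial x}\frac{\partial f_2}{\partial y}-\frac{\partial f_1}{\partial y}\frac{\partial f_2}{\partial x}$ is bounded on $\mathbb{R}^2$, then $G_f$ is a plane (an affine $2$-plane in $\mathbb{R}^4$).
   Context: Minimal means vanishing mean curvature vector; equivalently $f$ satisfies $(1+|f_y|^2)f_{xx}-2\langle f_x,f_y\rangle f_{xy}+(1+|f_x|^2)f_{yy}=0$. *)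

theory Defs
  imports "HOL-Analysis.Analysis"
begin

definition pd :: "real \<times> real \<Rightarrow> (real \<times> real \<Rightarrow> 'b::real_normed_vector) \<Rightarrow> real \<times> real \<Rightarrow> 'b" where
  "pd v g = (\<lambda>p. frechet_derivative g (at p) v)"

fun iter_pd :: "(real \<times> real) list \<Rightarrow> (real \<times> real \<Rightarrow> 'b::real_normed_vector) \<Rightarrow> real \<times> real \<Rightarrow> 'b" where
  "iter_pd [] g = g"
| "iter_pd (v # vs) g = pd v (iter_pd vs g)"

definition smooth_R2 :: "(real \<times> real \<Rightarrow> 'b::real_normed_vector) \<Rightarrow> bool" where
  "smooth_R2 g \<longleftrightarrow> (\<forall>vs p. iter_pd vs g differentiable (at p))"

abbreviation e1 :: "real \<times> real" where "e1 \<equiv> (1, 0)"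
abbreviation e2 :: "real \<times> real" where "e2 \<equiv> (0, 1)"

text \<open>Minimal surface system for the graph of f (vanishing mean curvature), as in the paper:
  (1+|f_y|^2) f_xx - 2 <f_x,f_y> f_xy + (1+|f_x|^2) f_yy = 0.\<close>
definition minimal_graph :: "(real \<times> real \<Rightarrow> real \<times> real) \<Rightarrow> bool" where
  "minimal_graph f \<longleftrightarrow> (\<forall>p.
     (1 + (norm (pd e2 f p))\<^sup>2) *\<^sub>R pd e1 (pd e1 f) p
     - (2 * (pd e1 f p \<bullet> pd e2 f p)) *\<^sub>R pd e2 (pd e1 f) p
     + (1 + (norm (pd e1 f p))\<^sup>2) *\<^sub>R pd e2 (pd e2 f) p = 0)"

definition jac_det :: "(real \<times> real \<Rightarrow> real \<times> real) \<Rightarrow> real \<times> real \<Rightarrow> real" where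
  "jac_det f p = fst (pd e1 f p) * snd (pd e2 f p) - fst (pd e2 f p) * snd (pd e1 f p)"

definition graph_R4 :: "(real \<times> real \<Rightarrow> real \<times> real) \<Rightarrow> ((real \<times> real) \<times> (real \<times> real)) set" where
  "graph_R4 f = {(p, f p) | p. True}"

end

theory Submission
  imports Defs "HOL-Complex_Analysis.Cauchy_Integral_Formula"
begin

text \<open>The minimal surface equation says that the metric coefficients \<open>E, F, G\<close> of the graph, divided by
  the area element \<open>W\<close>, satisfy \<open>(E/W)\<^sub>y = (F/W)\<^sub>x\<close> and \<open>(F/W)\<^sub>y = (G/W)\<^sub>x\<close>. Hence they form the Hessian
  of an entire convex function of Hessian determinant one, which is constant by a theorem of Joergens.
  So a linear change of the parameters makes the graph conformally parametrised, and then
  \<open>\<phi>\<^sub>k = (f\<^sub>k)\<^sub>u - i (f\<^sub>k)\<^sub>v\<close> are entire functions with \<open>\<phi>\<^sub>1\<^sup>2 + \<phi>\<^sub>2\<^sup>2\<close> constant. With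
  \<open>\<alpha> = \<phi>\<^sub>1 + i \<phi>\<^sub>2\<close> and \<open>\<beta> = \<phi>\<^sub>1 - i \<phi>\<^sub>2\<close>, the product \<open>\<alpha> \<beta>\<close> is constant and \<open>|\<alpha>|\<^sup>2 - |\<beta>|\<^sup>2\<close> is a
  multiple of the Jacobian; if the latter is bounded then so are \<open>\<alpha>\<close> and \<open>\<beta>\<close>, and Liouville's
  theorem makes \<open>df\<close> constant.\<close>

section \<open>Smooth maps of the plane\<close>

lemma iter_pd_append: "iter_pd (us @ vs) g = iter_pd us (iter_pd vs g)"
  by (induction us) auto

lemma smooth_R2_pd: "smooth_R2 g \<Longrightarrow> smooth_R2 (pd v g)"
  unfolding smooth_R2_def
  by (metis iter_pd.simps iter_pd_append)

lemma smooth_R2_has_derivative: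
  assumes "smooth_R2 g"
  shows "(g has_derivative (\<lambda>v. fst v *\<^sub>R pd e1 g p + snd v *\<^sub>R pd e2 g p)) (at p)"
proof -
  have "g differentiable at p"
    using assms unfolding smooth_R2_def by (metis iter_pd.simps(1))
  then have d: "(g has_derivative frechet_derivative g (at p)) (at p)"
    by (simp add: frechet_derivative_works)
  interpret linear "frechet_derivative g (at p)"
    using d by (rule has_derivative_linear)
  have "frechet_derivative g (at p) v = fst v *\<^sub>R pd e1 g p + snd v *\<^sub>R pd e2 g p" for v
  proof -
    have "v = fst v *\<^sub>R e1 + snd v *\<^sub>R e2"
      by (simp add: prod_eq_iff)
    then show ?thesis
      unfolding pd_def by (metis add scale)
  qed
  then show ?thesis
    using d by (metis (no_types, lifting) ext)
qed

lemma smooth_R2_continuous_on: "smooth_R2 g \<Longrightarrow> continuous_on S g"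
  by (meson smooth_R2_has_derivative has_derivative_continuous continuous_at_imp_continuous_on)

lemma smooth_R2_partial_fst:
  assumes "smooth_R2 g"
  shows "((\<lambda>x. g (x, y)) has_vector_derivative pd e1 g (x, y)) (at x within S)"
proof -
  have "((\<lambda>x. (x, y)) has_derivative (\<lambda>h. (h, 0))) (at x within S)"
    by (auto intro!: derivative_eq_intros)
  from has_derivative_compose[OF this smooth_R2_has_derivative[OF assms]]
  show ?thesis
    by (simp add: has_vector_derivative_def)
qed

lemma smooth_R2_partial_snd:
  assumes "smooth_R2 g"
  shows "((\<lambda>y. g (x, y)) has_vector_derivative pd e2 g (x, y)) (at y within S)"
proof -
  have "((\<lambda>y. (x, y)) has_derivative (\<lambda>h. (0, h))) (at y within S)"
    by (auto intro!: derivative_eq_intros)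
  from has_derivative_compose[OF this smooth_R2_has_derivative[OF assms]]
  show ?thesis
    by (simp add: has_vector_derivative_def)
qed

text \<open>Differentiating \<open>g(x,y) = g(x,c) + \<integral>\<^sub>c\<^sup>y g\<^sub>y(x,t) dt\<close> under the integral
  expresses \<open>g\<^sub>x\<close> as a primitive of \<open>g\<^sub>y\<^sub>x\<close>.\<close>
lemma pd_commute:
  fixes g :: "real \<times> real \<Rightarrow> 'b::euclidean_space"
  assumes g: "smooth_R2 g"
  shows "pd e2 (pd e1 g) p = pd e1 (pd e2 g) p"
proof -
  obtain x0 y0 where p: "p = (x0, y0)" by (cases p)
  \<comment> \<open>Any base point strictly below \<open>y0\<close> would do: \<open>y0\<close> is
    then interior to \<open>{c..y0 + 1}\<close>, so the derivative within that interval is the full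
    one.\<close>
  define c where "c = y0 - 1"
  define k where "k = pd e1 (pd e2 g)"
  have sk: "smooth_R2 k" and sg2: "smooth_R2 (pd e2 g)" and sg1: "smooth_R2 (pd e1 g)"
    using g by (auto simp: k_def intro: smooth_R2_pd)
  have cont_line: "continuous_on T (\<lambda>t. h (x, t))" if "smooth_R2 h"
    for h :: "real \<times> real \<Rightarrow> 'b" and x T
    by (rule continuous_on_compose2[OF smooth_R2_continuous_on[OF that, of UNIV]])
       (auto intro!: continuous_intros)
  have ftc: "integral {c..y} (\<lambda>t. pd e2 g (x, t)) = g (x, y) - g (x, c)" if "c \<le> y" for x y
    by (intro integral_unique fundamental_theorem_of_calculus that smooth_R2_partial_snd g)
  have primitive: "pd e1 g (x0, y) = pd e1 g (x0, c) + integral {c..y} (\<lambda>t. k (x0, t))" if "c \<le> y" for y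
  proof -
    have "((\<lambda>x. integral (cbox c y) (\<lambda>t. pd e2 g (x, t))) has_vector_derivative
        integral (cbox c y) (\<lambda>t. k (x0, t))) (at x0 within UNIV)"
      unfolding k_def
      by (rule leibniz_rule_vector_derivative)
         (auto intro!: smooth_R2_partial_fst sg2 integrable_continuous_real cont_line 
           smooth_R2_continuous_on[OF sk[unfolded k_def]])
    \<comment> \<open>The same function of \<open>x\<close> is a difference of two values of
      \<open>g\<close> by the fundamental theorem of calculus, so its derivative is known a second
      way and the two must agree.\<close>
    moreover have "((\<lambda>x. integral (cbox c y) (\<lambda>t. pd e2 g (x, t))) has_vector_derivative
        pd e1 g (x0, y) - pd e1 g (x0, c)) (at x0)"
      using that by (auto simp: ftc intro!: has_vector_derivative_diff smooth_R2_partial_fst g)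
    ultimately show ?thesis
      using vector_derivative_unique_at by fastforce
  qed
  have "((\<lambda>y. integral {c..y} (\<lambda>t. k (x0, t))) has_vector_derivative k (x0, y0))
      (at y0 within {c..y0 + 1})"
    by (rule integral_has_vector_derivative) (auto simp: c_def intro!: cont_line sk)
  then have "((\<lambda>y. pd e1 g (x0, c) + integral {c..y} (\<lambda>t. k (x0, t))) has_vector_derivative k (x0, y0))
      (at y0 within {c..y0 + 1})"
    by (auto intro!: derivative_eq_intros)
  then have "((\<lambda>y. pd e1 g (x0, y)) has_vector_derivative k (x0, y0)) (at y0 within {c..y0 + 1})"
    by (rule has_vector_derivative_transform[rotated 2]) (simp add: c_def, rule primitive, simp)
  moreover have "((\<lambda>y. pd e1 g (x0, y)) has_vector_derivative pd e2 (pd e1 g) (x0, y0)) (at y0 within {c..y0 + 1})"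
    by (intro smooth_R2_partial_snd sg1)
  moreover have "at y0 within {c..y0 + 1} = at y0"
    by (simp add: at_within_Icc_at c_def)
  ultimately show ?thesis
    unfolding p k_def by (metis vector_derivative_unique_at)
qed

text \<open>The potential is \<open>M(p) = \<integral>\<^sub>0\<^sup>1 (A(tp) x + B(tp) y) dt\<close>; by closedness the integrand of its
  \<open>x\<close>-derivative is \<open>d/dt (t A(tp))\<close>, and similarly for \<open>y\<close>.\<close>
lemma closed_form_exact:
  fixes A B :: "real \<times> real \<Rightarrow> real"
  assumes A: "\<And>p. (A has_derivative (\<lambda>v. fst v * Ax p + snd v * Ay p)) (at p)"
    and B: "\<And>p. (B has_derivative (\<lambda>v. fst v * Ay p + snd v * By p)) (at p)"
    and cont: "continuous_on UNIV Ax" "continuous_on UNIV Ay" "continuous_on UNIV By"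
  obtains M where "\<And>p. (M has_derivative (\<lambda>v. fst v * A p + snd v * B p)) (at p)"
proof -
  define M where "M x y = integral (cbox 0 1) (\<lambda>t::real. A (t*x, t*y) * x + B (t*x, t*y) * y)" for x y
  have cA: "continuous_on UNIV A" and cB: "continuous_on UNIV B"
    using A B by (meson has_derivative_continuous continuous_at_imp_continuous_on)+
  have comp: "continuous_on S (\<lambda>z. h (k z))" if "continuous_on UNIV h" "continuous_on S k"
    for h :: "real \<times> real \<Rightarrow> real" and k :: "'z::topological_space \<Rightarrow> real \<times> real" and S
    by (rule continuous_on_compose2[OF that]) auto
  note ci = comp[OF cA] comp[OF cB] comp[OF cont(1)] comp[OF cont(2)] comp[OF cont(3)]
  have chain: "((\<lambda>s. h (k s)) has_field_derivative (a * hx (k s) + b * hy (k s))) (at s within S)"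
    if h: "\<And>p. (h has_derivative (\<lambda>v. fst v * hx p + snd v * hy p)) (at p)"
      and k: "(k has_vector_derivative (a, b)) (at s within S)"
    for h hx hy :: "real \<times> real \<Rightarrow> real" and k s a b S
    unfolding has_field_derivative_def
    by (rule has_derivative_eq_rhs[OF has_derivative_compose[OF k[unfolded has_vector_derivative_def] h]])
       (auto simp: fun_eq_iff algebra_simps)
  have Dx: "((\<lambda>x. M x y) has_field_derivative A (x, y)) (at x)" for x y
  proof -
    have "((\<lambda>x. M x y) has_field_derivative integral (cbox 0 1)
        (\<lambda>t. (t * Ax (t*x, t*y) * x + A (t*x, t*y)) + t * Ay (t*x, t*y) * y)) (at x within UNIV)"
      unfolding M_def
    proof (rule leibniz_rule_field_derivative)
      fix x t :: real
      have k: "((\<lambda>x. (t*x, t*y)) has_vector_derivative (t, 0)) (at x)"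
        by (auto intro!: derivative_eq_intros simp: has_vector_derivative_def)
      show "((\<lambda>x. A (t*x, t*y) * x + B (t*x, t*y) * y) has_field_derivative
         (t * Ax (t*x, t*y) * x + A (t*x, t*y)) + t * Ay (t*x, t*y) * y) (at x)"
        by (auto intro!: derivative_eq_intros chain[OF A k] chain[OF B k])
    qed (auto intro!: integrable_continuous_real continuous_intros ci simp: split_beta)
    moreover have "integral (cbox 0 1)
        (\<lambda>t. (t * Ax (t*x, t*y) * x + A (t*x, t*y)) + t * Ay (t*x, t*y) * y) = 1 * A (1*x, 1*y) - 0 * A (0*x,0*y)"
      unfolding box_real
    proof (rule integral_unique[OF fundamental_theorem_of_calculus])
      fix t :: real
      have k: "((\<lambda>t. (t*x, t*y)) has_vector_derivative (x, y)) (at t within {0..1})"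
        by (auto intro!: derivative_eq_intros simp: has_vector_derivative_def)
      show "((\<lambda>t. t * A (t*x, t*y)) has_vector_derivative
          (t * Ax (t*x, t*y) * x + A (t*x, t*y)) + t * Ay (t*x, t*y) * y) (at t within {0..1})"
        unfolding has_real_derivative_iff_has_vector_derivative[symmetric]
        by (auto intro!: derivative_eq_intros chain[OF A k] simp: algebra_simps)
    qed auto
    ultimately show ?thesis by simp
  qed
  have Dy: "((\<lambda>y. M x y) has_field_derivative B (x, y)) (at y)" for x y
  proof -
    have "((\<lambda>y. M x y) has_field_derivative integral (cbox 0 1)
        (\<lambda>t. t * Ay (t*x, t*y) * x + (t * By (t*x, t*y) * y + B (t*x, t*y)))) (at y within UNIV)"
      unfolding M_def
    proof (rule leibniz_rule_field_derivative)
      fix y t :: real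
      have k: "((\<lambda>y. (t*x, t*y)) has_vector_derivative (0, t)) (at y)"
        by (auto intro!: derivative_eq_intros simp: has_vector_derivative_def)
      show "((\<lambda>y. A (t*x, t*y) * x + B (t*x, t*y) * y) has_field_derivative
         t * Ay (t*x, t*y) * x + (t * By (t*x, t*y) * y + B (t*x, t*y))) (at y)"
        by (auto intro!: derivative_eq_intros chain[OF A k] chain[OF B k])
    qed (auto intro!: integrable_continuous_real continuous_intros ci simp: split_beta)
    moreover have "integral (cbox 0 1)
        (\<lambda>t. t * Ay (t*x, t*y) * x + (t * By (t*x, t*y) * y + B (t*x, t*y))) = 1 * B (1*x, 1*y) - 0 * B (0*x,0*y)"
      unfolding box_real
    proof (rule integral_unique[OF fundamental_theorem_of_calculus])
      fix t :: real
      have k: "((\<lambda>t. (t*x, t*y)) has_vector_derivative (x, y)) (at t within {0..1})"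
        by (auto intro!: derivative_eq_intros simp: has_vector_derivative_def)
      show "((\<lambda>t. t * B (t*x, t*y)) has_vector_derivative
          t * Ay (t*x, t*y) * x + (t * By (t*x, t*y) * y + B (t*x, t*y))) (at t within {0..1})"
        unfolding has_real_derivative_iff_has_vector_derivative[symmetric]
        by (auto intro!: derivative_eq_intros chain[OF B k] simp: algebra_simps)
    qed auto
    ultimately show ?thesis by simp
  qed
  \<comment> \<open>Partial derivatives alone do not give a total derivative; continuity of the
    second one, \<open>B\<close>, supplies what is missing.\<close>
  have "((\<lambda>(x, y). M x y) has_derivative (\<lambda>(tx, ty). A (x, y) * tx + blinfun_mult_right (B (x, y)) ty))
      (at (x, y) within UNIV \<times> UNIV)" for x y
  proof (rule has_derivative_partialsI)
    show "((\<lambda>x. M x y) has_derivative (\<lambda>tx. A (x, y) * tx)) (at x)"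
      using Dx[of y x] by (simp add: has_field_derivative_def)
    show "((\<lambda>y. M x y) has_derivative blinfun_apply (blinfun_mult_right (B (x, y)))) (at y)" for x y
      using Dy[of x y] by (simp add: has_field_derivative_def)
    have "continuous_on UNIV (\<lambda>(x, y). blinfun_mult_right (B (x, y)))"
      using cB by (auto simp: split_beta intro!: continuous_intros bounded_linear.continuous_on[OF bounded_linear_blinfun_mult_right])
    then show "continuous (at (x, y) within UNIV \<times> UNIV) (\<lambda>(x, y). blinfun_mult_right (B (x, y)))"
      by (metis UNIV_I UNIV_Times_UNIV continuous_on_eq_continuous_within)
  qed auto
  from has_derivative_eq_rhs[OF this]
  have "((\<lambda>(x, y). M x y) has_derivative (\<lambda>v. fst v * A p + snd v * B p)) (at p)" for p
    by (cases p) (auto simp: fun_eq_iff)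
  then show thesis by (rule that)
qed

section \<open>Joergens' theorem\<close>

text \<open>Expansion gives injectivity, so the image is open by invariance of domain. It also pulls
  convergent sequences of image points back to Cauchy sequences, so the image is closed.
  Connectedness of the space then leaves only the whole space.\<close>

lemma surj_if_expanding:
  fixes T :: "'a::euclidean_space \<Rightarrow> 'a"
  assumes cont: "continuous_on UNIV T" and expand: "\<And>a b. dist a b \<le> dist (T a) (T b)"
  shows "surj T"
proof -
  have "inj T"
    by (intro injI) (metis expand dist_le_zero_iff dist_self)
  then have "open (range T)"
    by (intro invariance_of_domain_gen cont) auto
  moreover have "closed (range T)"
    unfolding closed_sequential_limits
  proof (intro allI impI, elim conjE)
    fix y l assume "\<forall>n. y n \<in> range T" and lim: "y \<longlonglongrightarrow> l"
    then have "\<forall>n. \<exists>x. y n = T x" by blast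
    then obtain x where x: "\<And>n. y n = T (x n)" by metis
    have "Cauchy x"
      using LIMSEQ_imp_Cauchy[OF lim] expand unfolding Cauchy_def x by (meson le_less_trans)
    then obtain x0 where "x \<longlonglongrightarrow> x0"
      using Cauchy_convergent_iff convergent_def by blast
    then have "(\<lambda>n. T (x n)) \<longlonglongrightarrow> T x0"
      by (rule isCont_tendsto_compose[rotated]) (use cont in \<open>simp add: continuous_on_eq_continuous_at\<close>)
    then show "l \<in> range T"
      using lim LIMSEQ_unique x by (metis (no_types, lifting) ext rangeI)
  qed
  ultimately show ?thesis
    using clopen[of "range T"] by blast
qed

text \<open>Joergens' theorem, in Nitsche's proof: if \<open>P\<close> is the gradient of a convex function whose Hessian
  has determinant one, Lewy's map \<open>T z = z + P z\<close> is a diffeomorphism of the plane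
  and \<open>\<zeta> \<mapsto> cnj (z - P z)\<close>, with \<open>T z = \<zeta>\<close>, is entire with derivative of modulus below one.\<close>
theorem unimodular_hessian_constant:
  fixes A B C :: "complex \<Rightarrow> real" and P :: "complex \<Rightarrow> complex"
  assumes P: "\<And>z. (P has_derivative
      (\<lambda>v. Complex (A z * Re v + B z * Im v) (B z * Re v + C z * Im v))) (at z)"
    and det: "\<And>z. A z * C z - (B z)\<^sup>2 = 1" and pos: "\<And>z. A z > 0"
  shows "A z = A w \<and> B z = B w \<and> C z = C w"
proof -
  define T where "T z = z + P z" for z
  \<comment> \<open>This is the Jacobian determinant of \<open>T\<close>: expanding
    \<open>(1 + A) (1 + C) - B^2\<close> and using \<open>A C - B^2 = 1\<close> gives
    \<open>2 + A + C\<close>.\<close>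
  define D where "D z = 2 + A z + C z" for z
  define gam where "gam z = Complex ((C z - A z) / D z) (2 * B z / D z)" for z
  have posC: "C z > 0" for z
  proof -
    have "A z * C z > 0" using det[of z] by (smt (verit) zero_le_power2)
    then show ?thesis using pos[of z] by (simp add: zero_less_mult_iff)
  qed
  have posD: "D z > 0" for z
    using pos[of z] posC[of z] by (simp add: D_def)
  have form_nonneg: "A z * x\<^sup>2 + 2 * B z * x * y + C z * y\<^sup>2 \<ge> 0" for z x y
  proof -
    have "A z * (A z * x\<^sup>2 + 2 * B z * x * y + C z * y\<^sup>2) = (A z * x + B z * y)\<^sup>2 + (A z * C z - (B z)\<^sup>2) * y\<^sup>2"
      by algebra
    also have "\<dots> \<ge> 0" by (simp add: det)
    finally show ?thesis using pos[of z] by (simp add: zero_le_mult_iff)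
  qed
  \<comment> \<open>Along the segment from \<open>b\<close> to \<open>a\<close>, the derivative of
    the inner product of \<open>P\<close> with \<open>a - b\<close> is the Hessian form at
    \<open>a - b\<close>, which is nonnegative. Monotonicity of \<open>P\<close> makes
    \<open>T\<close> expanding by Cauchy-Schwarz.\<close>
  have mono: "(P a - P b) \<bullet> (a - b) \<ge> 0" for a b
  proof -
    define phi where "phi t = P (b + t *\<^sub>R (a - b)) \<bullet> (a - b)" for t :: real
    have "phi 0 \<le> phi 1"
    proof (rule DERIV_nonneg_imp_nondecreasing[of 0 1 phi])
      fix t :: real
      let ?z = "b + t *\<^sub>R (a - b)" and ?d = "a - b"
      have "((\<lambda>t. b + t *\<^sub>R ?d) has_derivative (\<lambda>h. h *\<^sub>R ?d)) (at t)"
        by (auto intro!: derivative_eq_intros)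
      from has_derivative_inner_left[OF has_derivative_compose[OF this P], of ?d]
      have "(phi has_field_derivative (A ?z * (Re ?d)\<^sup>2 + 2 * B ?z * Re ?d * Im ?d + C ?z * (Im ?d)\<^sup>2)) (at t)"
        unfolding phi_def has_field_derivative_def
        by (rule has_derivative_eq_rhs) (auto simp: fun_eq_iff inner_complex_def power2_eq_square algebra_simps)
      then show "\<exists>y. (phi has_field_derivative y) (at t) \<and> y \<ge> 0"
        using form_nonneg by blast
    qed simp
    then show ?thesis by (simp add: phi_def inner_diff_left)
  qed
  have expand: "dist a b \<le> dist (T a) (T b)" for a b
  proof (cases "a = b")
    case False
    have "norm (a - b) * norm (a - b) = (a - b) \<bullet> (a - b)"
      by (simp add: power2_norm_eq_inner flip: power2_eq_square)
    also have "\<dots> \<le> (a - b) \<bullet> (a - b) + (P a - P b) \<bullet> (a - b)"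
      using mono by simp
    also have "\<dots> = (T a - T b) \<bullet> (a - b)"
      by (simp add: T_def inner_diff_left inner_add_left)
    also have "\<dots> \<le> norm (T a - T b) * norm (a - b)"
      by (rule norm_cauchy_schwarz)
    finally show ?thesis
      using False by (simp add: dist_norm)
  qed simp
  have T: "(T has_derivative (\<lambda>v. Complex ((1 + A z) * Re v + B z * Im v) (B z * Re v + (1 + C z) * Im v))) (at z)" for z
    unfolding T_def
    by (rule has_derivative_eq_rhs[OF has_derivative_add[OF has_derivative_ident P]])
       (auto simp: fun_eq_iff complex_eq_iff algebra_simps)
  have "continuous_on UNIV T"
    by (meson T has_derivative_continuous continuous_at_imp_continuous_on)
  then have "surj T"
    using expand by (rule surj_if_expanding)
  define S where "S = inv T"
  have TS: "T (S \<zeta>) = \<zeta>" for \<zeta>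
    using \<open>surj T\<close> by (simp add: S_def surj_f_inv_f)
  have "inj T"
    by (intro injI) (metis expand dist_le_zero_iff dist_self)
  then have ST: "S (T z) = z" for z
    by (simp add: S_def)
  have "dist (S a) (S b) \<le> dist a b" for a b
    using expand[of "S a" "S b"] by (simp add: TS)
  then have contS: "continuous (at \<zeta>) S" for \<zeta>
    unfolding continuous_at_eps_delta by (meson le_less_trans)
  \<comment> \<open>The inverse of the derivative of \<open>T\<close> at \<open>z\<close>, by the
    cofactor formula with determinant \<open>D z\<close>.\<close>
  define R where "R z v = Complex (((1 + C z) * Re v - B z * Im v) / D z) (((1 + A z) * Im v - B z * Re v) / D z)"
    for z v
  have blR: "bounded_linear (R z)" for z
    unfolding R_def linear_conv_bounded_linear[symmetric]
    by (auto intro!: linearI simp: complex_eq_iff algebra_simps add_divide_distrib diff_divide_distrib)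
  have detD: "(1 + A z) * (1 + C z) - (B z)\<^sup>2 = D z" for z
    using det[of z] by (simp add: D_def algebra_simps)
  have S: "(S has_derivative R (S \<zeta>)) (at \<zeta>)" for \<zeta>
  proof (rule has_derivative_inverse_basic[OF T blR _ contS open_UNIV])
    show "R (S \<zeta>) \<circ> (\<lambda>v. Complex ((1 + A (S \<zeta>)) * Re v + B (S \<zeta>) * Im v)
        (B (S \<zeta>) * Re v + (1 + C (S \<zeta>)) * Im v)) = id"
    proof (rule ext)
      fix v
      have "(1 + C (S \<zeta>)) * ((1 + A (S \<zeta>)) * Re v + B (S \<zeta>) * Im v) -
        B (S \<zeta>) * (B (S \<zeta>) * Re v + (1 + C (S \<zeta>)) * Im v) = Re v * D (S \<zeta>)"
        "(1 + A (S \<zeta>)) * (B (S \<zeta>) * Re v + (1 + C (S \<zeta>)) * Im v) - B (S \<zeta>) * ((1 + A (S \<zeta>)) * Re v + B (S \<zeta>) * Im v)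
         = Im v * D (S \<zeta>)"
        unfolding detD[symmetric] by (simp_all add: power2_eq_square algebra_simps)
      then show "(R (S \<zeta>) \<circ> (\<lambda>v. Complex ((1 + A (S \<zeta>)) * Re v + B (S \<zeta>) * Im v)
        (B (S \<zeta>) * Re v + (1 + C (S \<zeta>)) * Im v))) v = id v"
        using posD[of "S \<zeta>"] by (simp add: R_def complex_eq_iff)
    qed
  qed (auto simp: TS)
  define F where "F \<zeta> = cnj (S \<zeta> - P (S \<zeta>))" for \<zeta>
  \<comment> \<open>With \<open>H\<close> the Hessian, the matrix
    \<open>(I - H) (I + H)^(-1)\<close> is symmetric, and trace-free because
    \<open>det H = 1\<close>. Conjugation turns such a matrix into multiplication by a complex
    number, here \<open>gam\<close>.\<close>
  have F: "(F has_field_derivative gam (S \<zeta>)) (at \<zeta>)" for \<zeta>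
    unfolding has_field_derivative_def F_def
  proof (rule has_derivative_eq_rhs)
    show "((\<lambda>\<zeta>. cnj (S \<zeta> - P (S \<zeta>))) has_derivative (\<lambda>v. cnj (R (S \<zeta>) v -
        Complex (A (S \<zeta>) * Re (R (S \<zeta>) v) + B (S \<zeta>) * Im (R (S \<zeta>) v))
          (B (S \<zeta>) * Re (R (S \<zeta>) v) + C (S \<zeta>) * Im (R (S \<zeta>) v))))) (at \<zeta>)"
      by (intro has_derivative_cnj has_derivative_diff S has_derivative_compose[OF S P])
    show "(\<lambda>v. cnj (R (S \<zeta>) v -
        Complex (A (S \<zeta>) * Re (R (S \<zeta>) v) + B (S \<zeta>) * Im (R (S \<zeta>) v))
          (B (S \<zeta>) * Re (R (S \<zeta>) v) + C (S \<zeta>) * Im (R (S \<zeta>) v)))) = (*) (gam (S \<zeta>))"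
    proof (rule ext)
      fix v
      obtain a b c d x y where ab: "a = A (S \<zeta>)" "b = B (S \<zeta>)" "c = C (S \<zeta>)" "d = D (S \<zeta>)" "x = Re v" "y = Im v"
        by blast
      have d: "d \<noteq> 0" "d = 2 + a + c" and ac: "a * c - b\<^sup>2 = 1"
        using posD[of "S \<zeta>"] det[of "S \<zeta>"] by (auto simp: ab D_def)
      have "((1 + c) * x - b * y) - (a * ((1 + c) * x - b * y) + b * ((1 + a) * y - b * x)) = (c - a) * x - 2 * b * y"
        using ac by algebra
      moreover have "(b * ((1 + c) * x - b * y) + c * ((1 + a) * y - b * x)) - ((1 + a) * y - b * x) = (c - a) * y + 2 * b * x"
        using ac by algebra
      ultimately have "((1 + c) * x - b * y) / d - (a * (((1 + c) * x - b * y) / d) + b * (((1 + a) * y - b * x) / d))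
           = (c - a) / d * x - 2 * b / d * y"
        "(b * (((1 + c) * x - b * y) / d) + c * (((1 + a) * y - b * x) / d)) - ((1 + a) * y - b * x) / d
           = (c - a) / d * y + 2 * b / d * x"
        using d(1) by (simp_all add: divide_simps)
      then show "cnj (R (S \<zeta>) v -
        Complex (A (S \<zeta>) * Re (R (S \<zeta>) v) + B (S \<zeta>) * Im (R (S \<zeta>) v))
          (B (S \<zeta>) * Re (R (S \<zeta>) v) + C (S \<zeta>) * Im (R (S \<zeta>) v))) = gam (S \<zeta>) * v"
        unfolding ab by (simp add: R_def gam_def complex_eq_iff)
    qed
  qed
  \<comment> \<open>This identity is used twice: it bounds \<open>gam\<close> for Liouville's
    theorem, and it recovers \<open>D\<close> from \<open>gam\<close> once \<open>gam\<close> is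
    constant. \<open>D\<close> and \<open>gam\<close> together determine \<open>A\<close>,
    \<open>B\<close> and \<open>C\<close>.\<close>
  have norm_gam: "(norm (gam z))\<^sup>2 = 1 - 4 / D z" for z
  proof -
    have "(C z - A z)\<^sup>2 + (2 * B z)\<^sup>2 = (D z - 4) * D z"
      using det[of z] unfolding D_def by algebra
    moreover have "(norm (gam z))\<^sup>2 = ((C z - A z)\<^sup>2 + (2 * B z)\<^sup>2) / (D z)\<^sup>2"
      by (simp add: gam_def cmod_power2 power_divide add_divide_distrib)
    ultimately show ?thesis
      using posD[of z] by (simp add: power2_eq_square diff_divide_distrib)
  qed
  have "F holomorphic_on UNIV"
    using F by (meson field_differentiable_def field_differentiable_at_within holomorphic_onI)
  then have "deriv F holomorphic_on UNIV"
    by (simp add: holomorphic_deriv)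
  moreover have "deriv F = (\<lambda>\<zeta>. gam (S \<zeta>))"
    using F DERIV_imp_deriv by blast
  moreover have "norm (gam z) \<le> 1" for z
    by (rule power2_le_imp_le) (use norm_gam[of z] posD[of z] in simp_all)
  then have "bounded (range (\<lambda>\<zeta>. gam (S \<zeta>)))"
    by (auto simp: bounded_iff)
  ultimately obtain k where "\<And>\<zeta>. gam (S \<zeta>) = k"
    using Liouville_theorem unfolding constant_on_def by (metis UNIV_I)
  then have k: "gam z = k" for z
    by (metis ST)
  have "4 / D z = 4 / D w"
    using norm_gam[of z] norm_gam[of w] k by simp
  then have D: "D z = D w"
    using posD[of z] posD[of w] by (simp add: field_simps)
  then have "C z - A z = C w - A w" "B z = B w"
    using k[of z] k[of w] posD[of w] by (auto simp: gam_def)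
  with D show ?thesis by (simp add: D_def)
qed

section \<open>Minimal graphs\<close>

lemma has_derivative_Complex:
  assumes "(f has_derivative f') (at x within S)" "(g has_derivative g') (at x within S)"
  shows "((\<lambda>x. Complex (f x) (g x)) has_derivative (\<lambda>h. Complex (f' h) (g' h))) (at x within S)"
  unfolding Complex_eq using assms by (auto intro!: derivative_eq_intros)

text \<open>Both partial derivatives are put over the common denominator
  \<open>k p * sqrt (k p)\<close>, so that equality of mixed derivatives of the normalised metric
  reduces to polynomial identities between numerators.\<close>

lemma has_derivative_normalised:
  fixes h k :: "real \<times> real \<Rightarrow> real"
  assumes h: "(h has_derivative (\<lambda>v. fst v * hx + snd v * hy)) (at p)"
    and k: "(k has_derivative (\<lambda>v. fst v * kx + snd v * ky)) (at p)" and pos: "k p > 0"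
  shows "((\<lambda>p. h p / sqrt (k p)) has_derivative
    (\<lambda>v. fst v * ((hx * k p - h p * kx / 2) / (k p * sqrt (k p)))
       + snd v * ((hy * k p - h p * ky / 2) / (k p * sqrt (k p))))) (at p)"
proof (rule has_derivative_eq_rhs)
  show "((\<lambda>p. h p / sqrt (k p)) has_derivative (\<lambda>v.
      ((fst v * hx + snd v * hy) * sqrt (k p) - h p * ((fst v * kx + snd v * ky) * (inverse (sqrt (k p)) / 2)))
        / (sqrt (k p) * sqrt (k p)))) (at p)"
    by (rule has_derivative_divide'[OF h has_derivative_real_sqrt[OF _ k]]) (use pos in auto)
  define r where "r = sqrt (k p)"
  with pos have r: "r = sqrt (k p)" "r > 0" "k p = r\<^sup>2"
    by auto
  show "(\<lambda>v. ((fst v * hx + snd v * hy) * sqrt (k p) - h p * ((fst v * kx + snd v * ky) * (inverse (sqrt (k p)) / 2)))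
        / (sqrt (k p) * sqrt (k p))) =
    (\<lambda>v. fst v * ((hx * k p - h p * kx / 2) / (k p * sqrt (k p)))
       + snd v * ((hy * k p - h p * ky / 2) / (k p * sqrt (k p))))"
    unfolding r(1)[symmetric] r(3) using r(2)
    by (auto simp: fun_eq_iff field_simps power2_eq_square)
qed

text \<open>The quotients of the metric coefficients by the area element are constant by Joergens'
  theorem; \<open>A\<close>, \<open>B\<close>, \<open>C\<close> are these constants and
  \<open>W\<close> is the area element.\<close>

lemma minimal_graph_metric:
  fixes f :: "real \<times> real \<Rightarrow> real \<times> real"
  assumes f: "smooth_R2 f" and min: "minimal_graph f"
  obtains A B C W where "A > 0" "A * C - B\<^sup>2 = 1"
    "\<And>x. 1 + pd e1 f x \<bullet> pd e1 f x = A * W x"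
    "\<And>x. pd e1 f x \<bullet> pd e2 f x = B * W x"
    "\<And>x. 1 + pd e2 f x \<bullet> pd e2 f x = C * W x"
proof -
  define p q where "p = pd e1 f" and "q = pd e2 f"
  define a b c where "a = pd e1 p" and "b = pd e2 p" and "c = pd e2 q"
  have sm: "smooth_R2 p" "smooth_R2 q" "smooth_R2 a" "smooth_R2 b" "smooth_R2 c"
    using f by (auto simp: p_def q_def a_def b_def c_def intro: smooth_R2_pd)
  have b_eq: "pd e1 q = b"
    using pd_commute[OF f] by (auto simp: p_def q_def b_def)
  have dp: "(p has_derivative (\<lambda>v. fst v *\<^sub>R a x + snd v *\<^sub>R b x)) (at x)" for x
    using smooth_R2_has_derivative[OF sm(1)] by (simp add: a_def b_def)
  have dq: "(q has_derivative (\<lambda>v. fst v *\<^sub>R b x + snd v *\<^sub>R c x)) (at x)" for x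
    using smooth_R2_has_derivative[OF sm(2)] by (simp add: b_eq c_def)
  define E F G where "E x = 1 + p x \<bullet> p x" and "F x = p x \<bullet> q x" and "G x = 1 + q x \<bullet> q x" for x
  \<comment> \<open>The squared area element. By Cauchy-Schwarz it is at least \<open>1\<close>,
    which makes division by its root harmless.\<close>
  define K where "K x = E x * G x - (F x)\<^sup>2" for x
  have dE: "(E has_derivative (\<lambda>v. fst v * (2 * (p x \<bullet> a x)) + snd v * (2 * (p x \<bullet> b x)))) (at x)" for x
    unfolding E_def
    by (rule has_derivative_eq_rhs, (rule derivative_intros dp dq)+)
       (simp add: fun_eq_iff inner_add_right inner_add_left inner_commute algebra_simps)
  have dG: "(G has_derivative (\<lambda>v. fst v * (2 * (q x \<bullet> b x)) + snd v * (2 * (q x \<bullet> c x)))) (at x)" for x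
    unfolding G_def
    by (rule has_derivative_eq_rhs, (rule derivative_intros dp dq)+)
       (simp add: fun_eq_iff inner_add_right inner_add_left inner_commute algebra_simps)
  have dF: "(F has_derivative (\<lambda>v. fst v * (q x \<bullet> a x + p x \<bullet> b x) + snd v * (q x \<bullet> b x + p x \<bullet> c x))) (at x)" for x
    unfolding F_def
    by (rule has_derivative_eq_rhs, (rule derivative_intros dp dq)+)
       (simp add: fun_eq_iff inner_add_right inner_add_left inner_commute algebra_simps)
  define Kx where "Kx x = 2 * (G x * (p x \<bullet> a x) + E x * (q x \<bullet> b x) - F x * (q x \<bullet> a x + p x \<bullet> b x))" for x
  define Ky where "Ky x = 2 * (G x * (p x \<bullet> b x) + E x * (q x \<bullet> c x) - F x * (q x \<bullet> b x + p x \<bullet> c x))" for x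
  have dK: "(K has_derivative (\<lambda>v. fst v * Kx x + snd v * Ky x)) (at x)" for x
    unfolding K_def power2_eq_square
    by (rule has_derivative_eq_rhs, (rule derivative_intros dE dF dG)+)
       (simp add: fun_eq_iff Kx_def Ky_def algebra_simps)
  have K_pos: "K x > 0" for x
    using Cauchy_Schwarz_ineq[of "p x" "q x"]
    by (simp add: K_def E_def F_def G_def algebra_simps) (smt (verit) inner_ge_zero)
  have min_eq: "G x *\<^sub>R a x - (2 * F x) *\<^sub>R b x + E x *\<^sub>R c x = 0" for x
    using min[unfolded minimal_graph_def, rule_format, of x] unfolding p_def[symmetric] q_def[symmetric] a_def[symmetric]
      b_def[symmetric] c_def[symmetric] by (simp add: E_def F_def G_def power2_norm_eq_inner)
  have min_p: "G x * (p x \<bullet> a x) - 2 * F x * (p x \<bullet> b x) + E x * (p x \<bullet> c x) = 0"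
    and min_q: "G x * (q x \<bullet> a x) - 2 * F x * (q x \<bullet> b x) + E x * (q x \<bullet> c x) = 0" for x
    using arg_cong[OF min_eq, of "inner (p x)" x] arg_cong[OF min_eq, of "inner (q x)" x]
    by (simp_all add: inner_diff_right inner_add_right)
  \<comment> \<open>The two sides are the numerators of \<open>(E/W)_y\<close> and
    \<open>(F/W)_x\<close>. Their difference is a combination of the minimal surface equation paired
    with \<open>p\<close> and with \<open>q\<close>; \<open>div2\<close> treats
    \<open>(F/W)_y\<close> and \<open>(G/W)_x\<close> in the same way.\<close>
  have div1: "2 * (p x \<bullet> b x) * K x - E x * Ky x / 2 = (q x \<bullet> a x + p x \<bullet> b x) * K x - F x * Kx x / 2" for x
  proof -
    have "(q x \<bullet> a x + p x \<bullet> b x) * K x - F x * Kx x / 2 - (2 * (p x \<bullet> b x) * K x - E x * Ky x / 2)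
      = E x * (G x * (q x \<bullet> a x) - 2 * F x * (q x \<bullet> b x) + E x * (q x \<bullet> c x))
      - F x * (G x * (p x \<bullet> a x) - 2 * F x * (p x \<bullet> b x) + E x * (p x \<bullet> c x))"
      by (simp add: K_def Kx_def Ky_def power2_eq_square field_simps)
    then show ?thesis by (simp add: min_p min_q)
  qed
  have div2: "(q x \<bullet> b x + p x \<bullet> c x) * K x - F x * Ky x / 2 = 2 * (q x \<bullet> b x) * K x - G x * Kx x / 2" for x
  proof -
    have "(q x \<bullet> b x + p x \<bullet> c x) * K x - F x * Ky x / 2 - (2 * (q x \<bullet> b x) * K x - G x * Kx x / 2)
      = G x * (G x * (p x \<bullet> a x) - 2 * F x * (p x \<bullet> b x) + E x * (p x \<bullet> c x))
      - F x * (G x * (q x \<bullet> a x) - 2 * F x * (q x \<bullet> b x) + E x * (q x \<bullet> c x))"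
      by (simp add: K_def Kx_def Ky_def power2_eq_square field_simps)
    then show ?thesis by (simp add: min_p min_q)
  qed
  note dEW = has_derivative_normalised[OF dE dK K_pos]
  note dFW = has_derivative_normalised[OF dF dK K_pos]
  note dGW = has_derivative_normalised[OF dG dK K_pos]
  note conts = smooth_R2_continuous_on[OF sm(1)] smooth_R2_continuous_on[OF sm(2)]
     smooth_R2_continuous_on[OF sm(3)] smooth_R2_continuous_on[OF sm(4)] smooth_R2_continuous_on[OF sm(5)]
  have contEFG: "continuous_on UNIV E" "continuous_on UNIV F" "continuous_on UNIV G"
    unfolding E_def F_def G_def by (intro continuous_intros conts)+
  have contK: "continuous_on UNIV K" "continuous_on UNIV Kx" "continuous_on UNIV Ky"
    unfolding K_def Kx_def Ky_def by (intro continuous_intros conts contEFG)+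
  note ci = continuous_intros conts contEFG contK
  have cq: "continuous_on UNIV (\<lambda>x. (h x * K x - g x * k x / 2) / (K x * sqrt (K x)))"
    if "continuous_on UNIV h" "continuous_on UNIV g" "continuous_on UNIV k" for h g k :: "real \<times> real \<Rightarrow> real"
    using K_pos by (intro continuous_intros that contK) (auto simp: less_le)
  \<comment> \<open>Folding with \<open>div1\<close> and \<open>div2\<close> makes the mixed
    derivatives syntactically equal, as closedness is expressed by a shared function. The pair
    \<open>(M, N)\<close> then has a symmetric Jacobian and serves as the gradient map
    \<open>P\<close>; the convex potential itself is never built.\<close>
  obtain M where M: "\<And>x. (M has_derivative (\<lambda>v. fst v * (E x / sqrt (K x)) + snd v * (F x / sqrt (K x)))) (at x)"
    by (rule closed_form_exact[OF dEW dFW[folded div1]]) ((rule cq; intro ci) | blast)+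
  obtain N where N: "\<And>x. (N has_derivative (\<lambda>v. fst v * (F x / sqrt (K x)) + snd v * (G x / sqrt (K x)))) (at x)"
    by (rule closed_form_exact[OF dFW dGW[folded div2]]) ((rule cq; intro ci) | blast)+
  define L where "L z = (Re z, Im z)" for z
  have dL: "(L has_derivative (\<lambda>v. (Re v, Im v))) (at z)" for z
    unfolding L_def by (auto intro!: derivative_eq_intros)
  have E_pos: "E x > 0" for x
    by (simp add: E_def add_pos_nonneg)
  have const: "E (L z) / sqrt (K (L z)) = E (L w) / sqrt (K (L w)) \<and>
      F (L z) / sqrt (K (L z)) = F (L w) / sqrt (K (L w)) \<and>
      G (L z) / sqrt (K (L z)) = G (L w) / sqrt (K (L w))" for z w
  proof (rule unimodular_hessian_constant)
    fix z
    show "((\<lambda>z. Complex (M (L z)) (N (L z))) has_derivative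
      (\<lambda>v. Complex (E (L z) / sqrt (K (L z)) * Re v + F (L z) / sqrt (K (L z)) * Im v)
        (F (L z) / sqrt (K (L z)) * Re v + G (L z) / sqrt (K (L z)) * Im v))) (at z)"
      by (rule has_derivative_eq_rhs, (rule has_derivative_Complex has_derivative_compose[OF dL] M N)+)
         (simp add: fun_eq_iff mult.commute)
    show "E (L z) / sqrt (K (L z)) * (G (L z) / sqrt (K (L z))) - (F (L z) / sqrt (K (L z)))\<^sup>2 = 1"
      using K_pos[of "L z"] by (simp add: power_divide flip: diff_divide_distrib) (simp add: K_def)
    show "E (L z) / sqrt (K (L z)) > 0"
      using K_pos E_pos by simp
  qed
  have L: "x = L (Complex (fst x) (snd x))" for x
    by (simp add: L_def)
  define x0 where "x0 = (0 :: real \<times> real)"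
  have "E x / sqrt (K x) = E x0 / sqrt (K x0)" "F x / sqrt (K x) = F x0 / sqrt (K x0)"
     "G x / sqrt (K x) = G x0 / sqrt (K x0)" for x
    using const by (metis L)+
  then have "E x = E x0 / sqrt (K x0) * sqrt (K x)" "F x = F x0 / sqrt (K x0) * sqrt (K x)"
     "G x = G x0 / sqrt (K x0) * sqrt (K x)" for x
    using K_pos[of x] by (metis less_irrefl nonzero_eq_divide_eq real_sqrt_gt_zero)+
  moreover have "E x0 / sqrt (K x0) > 0"
    using K_pos E_pos by simp
  moreover have "E x0 / sqrt (K x0) * (G x0 / sqrt (K x0)) - (F x0 / sqrt (K x0))\<^sup>2 = 1"
    using K_pos[of x0] by (simp add: power_divide flip: diff_divide_distrib) (simp add: K_def)
  ultimately show thesis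
    using that[of "E x0 / sqrt (K x0)" "G x0 / sqrt (K x0)" "F x0 / sqrt (K x0)" "\<lambda>x. sqrt (K x)"]
    unfolding E_def F_def G_def p_def q_def by blast
qed

text \<open>The isothermal coordinates are given by \<open>(x, y) = (u - B v, A v)\<close>.\<close>
lemma constant_metric_gradient:
  fixes f :: "real \<times> real \<Rightarrow> real \<times> real"
  assumes f: "smooth_R2 f" and min: "minimal_graph f"
    and jac: "\<And>x. \<bar>jac_det f x\<bar> \<le> J"
    and A: "A > 0" and det: "A * C - B\<^sup>2 = 1"
    and E: "\<And>x. 1 + pd e1 f x \<bullet> pd e1 f x = A * W x"
    and F: "\<And>x. pd e1 f x \<bullet> pd e2 f x = B * W x"
    and G: "\<And>x. 1 + pd e2 f x \<bullet> pd e2 f x = C * W x"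
  shows "pd e1 f x = pd e1 f y \<and> pd e2 f x = pd e2 f y"
proof -
  define p q where "p = pd e1 f" and "q = pd e2 f"
  define a b c where "a = pd e1 p" and "b = pd e2 p" and "c = pd e2 q"
  have sm: "smooth_R2 p" "smooth_R2 q"
    using f by (auto simp: p_def q_def intro: smooth_R2_pd)
  have b_eq: "pd e1 q = b"
    using pd_commute[OF f] by (auto simp: p_def q_def b_def)
  have dp: "(p has_derivative (\<lambda>v. fst v *\<^sub>R a x + snd v *\<^sub>R b x)) (at x)" for x
    using smooth_R2_has_derivative[OF sm(1)] by (simp add: a_def b_def)
  have dq: "(q has_derivative (\<lambda>v. fst v *\<^sub>R b x + snd v *\<^sub>R c x)) (at x)" for x
    using smooth_R2_has_derivative[OF sm(2)] by (simp add: b_eq c_def)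
  have W: "W x > 0" for x
  proof -
    have "A * W x > 0"
      using inner_ge_zero[of "pd e1 f x"] by (simp flip: E add: add_pos_nonneg)
    then show ?thesis using A by (simp add: zero_less_mult_iff)
  qed
  \<comment> \<open>The metric being a constant form times \<open>W\<close>, the minimal surface
    equation loses its nonlinearity after division by \<open>W\<close>.\<close>
  have elliptic: "C * (a x \<bullet> e) - 2 * B * (b x \<bullet> e) + A * (c x \<bullet> e) = 0" for x e
  proof -
    have "(C * W x) *\<^sub>R a x - (2 * (B * W x)) *\<^sub>R b x + (A * W x) *\<^sub>R c x = 0"
      using min[unfolded minimal_graph_def, rule_format, of x]
      by (simp add: power2_norm_eq_inner E F G a_def b_def c_def p_def q_def)
    from arg_cong[OF this, of "\<lambda>v. v \<bullet> e"]
    have "W x * (C * (a x \<bullet> e) - 2 * B * (b x \<bullet> e) + A * (c x \<bullet> e)) = 0"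
      by (simp add: inner_diff_left inner_add_left algebra_simps)
    then show ?thesis using W[of x] by simp
  qed
  define L where "L z = (Re z - B * Im z, A * Im z)" for z
  have dL: "(L has_derivative (\<lambda>v. (Re v - B * Im v, A * Im v))) (at z)" for z
    unfolding L_def by (auto intro!: derivative_eq_intros)
  \<comment> \<open>\<open>p\<close> and \<open>r\<close> at \<open>L z\<close> are the
    \<open>u\<close>- and \<open>v\<close>-derivatives of \<open>f\<close> composed with
    \<open>L\<close>, so \<open>phi e\<close> is \<open>h_u - i h_v\<close> for the component
    \<open>h\<close> of that map along \<open>e\<close>.\<close>
  define r where "r x = A *\<^sub>R q x - B *\<^sub>R p x" for x
  define phi where "phi e z = Complex (p (L z) \<bullet> e) (- (r (L z) \<bullet> e))" for e z
  have dphi: "(phi e has_field_derivative Complex (a (L z) \<bullet> e) (B * (a (L z) \<bullet> e) - A * (b (L z) \<bullet> e))) (at z)"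
    for e z
  proof -
    define a' b' c' where "a' = a (L z) \<bullet> e" and "b' = b (L z) \<bullet> e" and "c' = c (L z) \<bullet> e"
    \<comment> \<open>In the coordinates \<open>(u, v)\<close> this says
      \<open>h_vv = - h_uu\<close>: each component is harmonic, which yields the Cauchy-Riemann
      equations for \<open>phi e\<close>.\<close>
    have "A * (A * c' - 2 * B * b') + B\<^sup>2 * a' = - a'"
      using elliptic[of "L z" e] det unfolding a'_def[symmetric] b'_def[symmetric] c'_def[symmetric]
      by algebra
    then have harmonic: "A * (A * c') = A * (2 * B * b') - B * (B * a') - a'"
      by (simp add: algebra_simps power2_eq_square)
    have "(phi e has_derivative (\<lambda>v. Complex
        (((Re v - B * Im v) *\<^sub>R a (L z) + (A * Im v) *\<^sub>R b (L z)) \<bullet> e)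
        (- ((A *\<^sub>R ((Re v - B * Im v) *\<^sub>R b (L z) + (A * Im v) *\<^sub>R c (L z))
           - B *\<^sub>R ((Re v - B * Im v) *\<^sub>R a (L z) + (A * Im v) *\<^sub>R b (L z))) \<bullet> e)))) (at z)"
      unfolding phi_def r_def
      using has_derivative_compose[OF dL dp, of z] has_derivative_compose[OF dL dq, of z]
      by (intro has_derivative_Complex has_derivative_minus has_derivative_inner_left has_derivative_diff
          has_derivative_scaleR_right) simp_all
    then show ?thesis
      unfolding has_field_derivative_def
    proof (rule has_derivative_eq_rhs)
      have "- (A * ((x - B * y) * b' + A * y * c') - B * ((x - B * y) * a' + A * y * b'))
          = a' * y + (B * a' - A * b') * x" for x y
      proof -
        have "A * ((x - B * y) * b' + A * y * c') - B * ((x - B * y) * a' + A * y * b')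
          = (A * (A * c')) * y + A * b' * x - 2 * A * B * b' * y - B * a' * x + B * (B * a') * y"
          by (simp add: algebra_simps)
        then show ?thesis unfolding harmonic by (simp add: algebra_simps)
      qed
      then show "(\<lambda>v. Complex
        (((Re v - B * Im v) *\<^sub>R a (L z) + (A * Im v) *\<^sub>R b (L z)) \<bullet> e)
        (- ((A *\<^sub>R ((Re v - B * Im v) *\<^sub>R b (L z) + (A * Im v) *\<^sub>R c (L z))
           - B *\<^sub>R ((Re v - B * Im v) *\<^sub>R a (L z) + (A * Im v) *\<^sub>R b (L z))) \<bullet> e)))
        = (*) (Complex (a (L z) \<bullet> e) (B * (a (L z) \<bullet> e) - A * (b (L z) \<bullet> e)))"
        by (simp add: fun_eq_iff complex_eq_iff inner_add_left inner_diff_left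
            flip: a'_def b'_def c'_def) (simp add: algebra_simps)
    qed
  qed
  have hol: "phi e holomorphic_on UNIV" for e
    using dphi by (meson field_differentiable_def field_differentiable_at_within holomorphic_onI)
  define alpha beta where "alpha z = phi (1, 0) z + \<i> * phi (0, 1) z"
    and "beta z = phi (1, 0) z - \<i> * phi (0, 1) z" for z
  \<comment> \<open>Conformality means that the squares for all four coordinates of the graph sum to
    zero. The base coordinates \<open>u - B v\<close> and \<open>A v\<close> contribute
    \<open>(1 + i B)^2 + (- i A)^2\<close>, and \<open>d\<close> is its negative.\<close>
  define d where "d = Complex (A\<^sup>2 + B\<^sup>2 - 1) (- 2 * B)"
  have prod: "alpha z * beta z = d" for z
  proof -
    define P Q where "P = p (L z)" and "Q = q (L z)"
    have EFG: "P \<bullet> P = A * W (L z) - 1" "P \<bullet> Q = B * W (L z)" "Q \<bullet> Q = C * W (L z) - 1"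
      using E[of "L z"] F[of "L z"] G[of "L z"] by (simp_all add: P_def Q_def p_def q_def)
    have re: "P \<bullet> P - (A *\<^sub>R Q - B *\<^sub>R P) \<bullet> (A *\<^sub>R Q - B *\<^sub>R P) = A\<^sup>2 + B\<^sup>2 - 1"
    proof -
      have "P \<bullet> P - (A *\<^sub>R Q - B *\<^sub>R P) \<bullet> (A *\<^sub>R Q - B *\<^sub>R P)
        = P \<bullet> P - (A\<^sup>2 * (Q \<bullet> Q) - 2 * A * B * (P \<bullet> Q) + B\<^sup>2 * (P \<bullet> P))"
        by (simp add: inner_diff_left inner_diff_right inner_commute power2_eq_square algebra_simps)
      also have "\<dots> = A\<^sup>2 + B\<^sup>2 - 1"
        unfolding EFG using det by algebra
      finally show ?thesis .
    qed
    have im: "P \<bullet> (A *\<^sub>R Q - B *\<^sub>R P) = B"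
    proof -
      have "P \<bullet> (A *\<^sub>R Q - B *\<^sub>R P) = A * (P \<bullet> Q) - B * (P \<bullet> P)"
        by (simp add: inner_diff_right)
      also have "\<dots> = B"
        unfolding EFG by (simp add: algebra_simps)
      finally show ?thesis .
    qed
    define R where "R = A *\<^sub>R Q - B *\<^sub>R P"
    have "alpha z * beta z = (phi (1, 0) z)\<^sup>2 + (phi (0, 1) z)\<^sup>2"
      by (simp add: alpha_def beta_def algebra_simps power2_eq_square)
    also have "\<dots> = Complex (P \<bullet> P - R \<bullet> R) (- 2 * (P \<bullet> R))"
      by (cases P; cases R) (simp add: phi_def r_def P_def Q_def R_def complex_eq_iff power2_eq_square inner_prod_def
         algebra_simps)
    finally show ?thesis
      using re im by (simp add: R_def d_def)
  qed
  \<comment> \<open>The factor \<open>A\<close> is the determinant of \<open>L\<close>.\<close>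
  have diff: "(norm (alpha z))\<^sup>2 - (norm (beta z))\<^sup>2 = 4 * A * jac_det f (L z)" for z
    unfolding cmod_power2
    by (simp add: alpha_def beta_def phi_def r_def jac_det_def p_def q_def power2_eq_square inner_prod_def algebra_simps)
  \<comment> \<open>The square of the smaller of \<open>s\<close> and \<open>t\<close> is at most
    their product \<open>norm d\<close>, and that of the larger exceeds it by at most
    \<open>4 * A * J\<close>.\<close>
  have bound: "s\<^sup>2 \<le> 4 * A * J + norm d"
    if "s * t = norm d" "\<bar>s\<^sup>2 - t\<^sup>2\<bar> \<le> 4 * A * J" "s \<ge> 0" "t \<ge> 0" for s t :: real
  proof (cases "s \<le> t")
    case True
    then have "s * s \<le> s * t" using that by (intro mult_left_mono)
    then show ?thesis using that by (simp add: power2_eq_square)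
  next
    case False
    then have "t * t \<le> s * t" using that by (intro mult_right_mono) auto
    then show ?thesis using that by (simp add: power2_eq_square)
  qed
  have diff_le: "\<bar>(norm (alpha z))\<^sup>2 - (norm (beta z))\<^sup>2\<bar> \<le> 4 * A * J" for z
    unfolding diff using A jac[of "L z"] by (simp add: abs_mult)
  have prod_norm: "norm (alpha z) * norm (beta z) = norm d" for z
    by (simp add: prod flip: norm_mult)
  have "(norm (alpha z))\<^sup>2 \<le> 4 * A * J + norm d" for z
    by (rule bound[OF prod_norm diff_le]) auto
  then have bda: "bounded (range alpha)"
    unfolding bounded_iff by (auto intro: exI[of _ "sqrt (4 * A * J + norm d)"] real_le_rsqrt)
  have "(norm (beta z))\<^sup>2 \<le> 4 * A * J + norm d" for z
    by (rule bound[of _ "norm (alpha z)"]) (use prod_norm[of z] diff_le[of z] in \<open>auto simp: mult.commute abs_minus_commute\<close>)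
  then have bdb: "bounded (range beta)"
    unfolding bounded_iff by (auto intro: exI[of _ "sqrt (4 * A * J + norm d)"] real_le_rsqrt)
  have "alpha holomorphic_on UNIV" "beta holomorphic_on UNIV"
    unfolding alpha_def beta_def by (intro holomorphic_intros hol)+
  with bda bdb have "alpha constant_on UNIV" "beta constant_on UNIV"
    by (auto intro: Liouville_theorem)
  then obtain ka kb where k: "\<And>z. alpha z = ka" "\<And>z. beta z = kb"
    unfolding constant_on_def by auto
  have "2 * phi (1, 0) z = ka + kb" "2 * \<i> * phi (0, 1) z = ka - kb" for z
    unfolding k[of z, symmetric] alpha_def beta_def by auto
  then have "phi (1, 0) z = (ka + kb) / 2" "phi (0, 1) z = (ka - kb) / (2 * \<i>)" for z
    by (simp_all add: field_simps)
  then have phi_const: "phi (1, 0) z = phi (1, 0) w \<and> phi (0, 1) z = phi (0, 1) w" for z w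
    by metis
  have pr: "p (L z) = p (L w) \<and> r (L z) = r (L w)" for z w
    using phi_const[of z w] by (simp add: phi_def inner_prod_def prod_eq_iff)
  \<comment> \<open>\<open>L\<close> is inverted explicitly, so constancy in \<open>(u, v)\<close>
    carries over to every point of the plane.\<close>
  have "L (Complex (fst x + B / A * snd x) (snd x / A)) = x" for x
    using A by (simp add: L_def prod_eq_iff)
  then have "p x = p y" "r x = r y"
    using pr[of "Complex (fst x + B / A * snd x) (snd x / A)" "Complex (fst y + B / A * snd y) (snd y / A)"]
    by simp_all
  then show ?thesis
    using A by (simp add: r_def p_def q_def)
qed

section \<open>From a constant gradient to an affine plane\<close>

lemma affine_graph:
  fixes g :: "'a::euclidean_space \<Rightarrow> 'b::euclidean_space"
  assumes g: "linear g"
  shows "affine (range (\<lambda>x. (x, k + g x))) \<and> aff_dim (range (\<lambda>x. (x, k + g x))) = DIM('a)"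
proof -
  define h where "h x = (x, g x)" for x
  have h: "linear h"
    unfolding h_def using g by (auto intro!: linearI simp: linear_add linear_scale)
  have "inj h" by (auto simp: h_def inj_def)
  have eq: "range (\<lambda>x. (x, k + g x)) = (+) (0, k) ` range h"
    by (auto simp: h_def image_iff)
  have "affine (range h)"
    using h by (simp add: subspace_imp_affine linear_subspace_image)
  moreover have "aff_dim (range h) = DIM('a)"
    using h \<open>inj h\<close> by simp
  ultimately show ?thesis
    unfolding eq by (simp add: aff_dim_translation_eq flip: affine_translation)
qed

theorem theorem1p1:
  fixes f :: "real \<times> real \<Rightarrow> real \<times> real"
  assumes "smooth_R2 f"
    and "minimal_graph f"
    and "\<exists>B. \<forall>p. \<bar>jac_det f p\<bar> \<le> B"
  shows "affine (graph_R4 f) \<and> aff_dim (graph_R4 f) = 2"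
proof -
  obtain J where J: "\<And>x. \<bar>jac_det f x\<bar> \<le> J"
    using assms(3) by blast
  obtain A B C W where "A > 0" "A * C - B\<^sup>2 = 1"
    "\<And>x. 1 + pd e1 f x \<bullet> pd e1 f x = A * W x"
    "\<And>x. pd e1 f x \<bullet> pd e2 f x = B * W x"
    "\<And>x. 1 + pd e2 f x \<bullet> pd e2 f x = C * W x"
    by (rule minimal_graph_metric[OF assms(1,2)]) (rule that)
  note const = constant_metric_gradient[OF assms(1,2) J this]
  define g where "g v = fst v *\<^sub>R pd e1 f 0 + snd v *\<^sub>R pd e2 f 0" for v :: "real \<times> real"
  have "linear g"
    by (auto intro!: linearI simp: g_def algebra_simps)
  have df: "(f has_derivative g) (at x)" for x
    using smooth_R2_has_derivative[OF assms(1), of x] const[of x 0] by (simp add: g_def[abs_def])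
  have dg: "(g has_derivative g) (at x)" for x
    using \<open>linear g\<close> by (simp add: linear_imp_has_derivative)
  have diff: "f x - g x = f 0 - g 0" for x
    using has_derivative_zero_unique[of UNIV "\<lambda>x. f x - g x"] has_derivative_diff[OF df dg] by simp
  define k where "k = f 0"
  have "f x = k + g x" for x
    using diff[of x] linear_0[OF \<open>linear g\<close>] by (simp add: k_def algebra_simps)
  then have "graph_R4 f = range (\<lambda>x. (x, k + g x))"
    by (auto simp: graph_R4_def)
  then show ?thesis
    using affine_graph[OF \<open>linear g\<close>, of k] by simp
qed

end
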